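(* Let $\mathbb{K}$ be a field, $R=\mathbb{K}[x_1,\dots,x_n]$ with $n\ge 1$, let $W=[w_1,\dots,w_n]$ be a vector of positive integers, let $\prec_W$ be a generalized weighted degree ordering on the monomials of $R$ with weight vector $W$, let $I\subseteq R$ be an ideal with initial ideal $\bar I=\mathrm{in}_{\prec_W}(I)$, and let $\mathcal{G}$ be a Groebner basis of $I$ with respect to $\prec_W$. Let $d=\mathrm{lcm}(w_1,\dots,w_n)$, and let $H_{R/\bar I}$, $P^W_{R/\bar I}=\{P_0,\dots,P_{d-1}\}$ and $\mathrm{ri}^W(R/\bar I)$ be the Hilbert function, the Hilbert quasi-polynomial and the generalized regularity index of $R/\bar I$ with respect to $W$. Suppose that (1) every $g\in\mathcal{G}$ has exactly two monomials of highest weight in its support, and (2) $H_{R/\bar I}(k)\in\{0,1\}$ for all integers $0\le k<\mathrm{ri}^W(R/\bar I)$, and each $P_i$ ($0\le i\le d-1$) is the constant polynomial $0$ or the constant polynomial $1$. Then the pair $(R/I,\prec_W)$ is an order domain.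
   Context: Weights: $x_i$ has weight $w_i\in\mathbb{N}_+$ (positive integers), and $\mathrm{w}(x_1^{\alpha_1}\cdots x_n^{\alpha_n})=\alpha_1w_1+\cdots+\alpha_nw_n$. Generalized weighted degree ordering: given a monomial ordering $\prec_{\mathcal M}$ on the monomials of $R$, $X^\alpha\prec_W X^\beta$ iff either $\mathrm{w}(X^\alpha)<\mathrm{w}(X^\beta)$, or $\mathrm{w}(X^\alpha)=\mathrm{w}(X^\beta)$ and $X^\alpha\prec_{\mathcal M}X^\beta$. Initial ideal and staircase: $\mathrm{in}_{\prec_W}(I)$ is the ideal generated by the leading terms with respect to $\prec_W$ of the nonzero elements of $I$; the Hilbert staircase $\mathcal{N}_{\prec_W}(I)$ is the set of monomials of $R$ that are not the leading monomial of any polynomial in $I$. The support of a polynomial is the set of monomials occurring in it with nonzero coefficient. Order domain (for a pair): the pair $(R/I,\prec_W)$ is called an order domain if $I$ has a Groebner basis $\mathcal{G}$ with respect to $\prec_W$ such that (C1) every $g\in\mathcal{G}$ has exactly two monomials of highest weight in its support, and (C2) no two distinct monomials in $\mathcal{N}_{\prec_W}(I)$ have the same weight. Hilbert function: an ideal $J\subseteq R$ is $W$-homogeneous if it is generated by polynomials each of whose nonzero terms all have the same weight (monomial ideals are $W$-homogeneous). For such $J$, $(R/J)_k$ is the image in $R/J$ of the $\mathbb{K}$-span of the monomials of weight $k$, and $H_{R/J}(k)=\dim_{\mathbb{K}}(R/J)_k$ for $k\in\mathbb{N}$ (with $0\in\mathbb{N}$). Hilbert quasi-polynomial: with $d=\mathrm{lcm}(w_1,\dots,w_n)$,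 $P^W_{R/J}=\{P_0,\dots,P_{d-1}\}$ is the unique family of polynomials in $\mathbb{Q}[x]$ such that $H_{R/J}(k)=P_i(k)$ for all sufficiently large $k$ with $k\equiv i \pmod d$; write $P^W_{R/J}(k)=P_i(k)$ when $k\equiv i\pmod d$. The generalized regularity index $\mathrm{ri}^W(R/J)$ is the least $k_0\in\mathbb{N}$ such that $H_{R/J}(k)=P^W_{R/J}(k)$ for all $k\ge k_0$. *)

theory Defs
  imports
    "HOL-Library.Poly_Mapping"
    "HOL-Computational_Algebra.Polynomial"
    "HOL-Algebra.Embedded_Algebras"
    "HOL-Algebra.QuotRing"
    "HOL-Algebra.Algebraic_Closure_Type"
begin

text \<open>
  The variables are indexed by a finite type \<open>'n\<close> (types are nonempty, so there is at least
  one variable). A monomial is identified with its exponent vector, so multiplication of monomials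
  is addition of exponent vectors. Ideals, quotients and dimensions are those of HOL-Algebra,
  taken in the record version of the polynomial ring.
\<close>

type_synonym 'n monom = "'n \<Rightarrow>\<^sub>0 nat"
type_synonym ('n, 'k) mpoly = "('n \<Rightarrow>\<^sub>0 nat) \<Rightarrow>\<^sub>0 'k"

abbreviation mpoly_ring :: "('n::finite, 'k::field) mpoly ring" where
  "mpoly_ring \<equiv> ring_of_type_algebra"

definition weight :: "('n::finite \<Rightarrow> nat) \<Rightarrow> 'n monom \<Rightarrow> nat" where
  "weight w a = (\<Sum>i\<in>UNIV. Poly_Mapping.lookup a i * w i)"

text \<open>All orderings are given by their strict part.\<close>

definition monomial_ordering :: "('n monom \<Rightarrow> 'n monom \<Rightarrow> bool) \<Rightarrow> bool" where
  "monomial_ordering lt \<longleftrightarrow>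
     irreflp lt \<and> transp lt \<and> totalp lt \<and> wfp lt \<and>
     (\<forall>a b c. lt a b \<longrightarrow> lt (a + c) (b + c))"

definition weighted_less ::
  "('n::finite \<Rightarrow> nat) \<Rightarrow> ('n monom \<Rightarrow> 'n monom \<Rightarrow> bool) \<Rightarrow> 'n monom \<Rightarrow> 'n monom \<Rightarrow> bool" where
  "weighted_less w lt a b \<longleftrightarrow> weight w a < weight w b \<or> (weight w a = weight w b \<and> lt a b)"

text \<open>Leading monomials and terms are meaningful for nonzero polynomials only.\<close>

definition lead_monom ::
  "('n monom \<Rightarrow> 'n monom \<Rightarrow> bool) \<Rightarrow> ('n, 'k::zero) mpoly \<Rightarrow> 'n monom" where
  "lead_monom lt p =
     (THE a. a \<in> Poly_Mapping.keys p \<and> (\<forall>b\<in>Poly_Mapping.keys p. b \<noteq> a \<longrightarrow> lt b a))"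

definition lead_term ::
  "('n monom \<Rightarrow> 'n monom \<Rightarrow> bool) \<Rightarrow> ('n, 'k::zero) mpoly \<Rightarrow> ('n, 'k) mpoly" where
  "lead_term lt p =
     Poly_Mapping.single (lead_monom lt p) (Poly_Mapping.lookup p (lead_monom lt p))"

definition initial_ideal ::
  "('n::finite monom \<Rightarrow> 'n monom \<Rightarrow> bool) \<Rightarrow> ('n, 'k::field) mpoly set \<Rightarrow> ('n, 'k) mpoly set" where
  "initial_ideal lt I = Idl\<^bsub>mpoly_ring\<^esub> (lead_term lt ` (I - {0}))"

definition staircase ::
  "('n monom \<Rightarrow> 'n monom \<Rightarrow> bool) \<Rightarrow> ('n, 'k::zero) mpoly set \<Rightarrow> 'n monom set" where
  "staircase lt I = {a. \<not> (\<exists>p\<in>I - {0}. lead_monom lt p = a)}"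

definition groebner_basis ::
  "('n::finite monom \<Rightarrow> 'n monom \<Rightarrow> bool) \<Rightarrow> ('n, 'k::field) mpoly set \<Rightarrow> ('n, 'k) mpoly set \<Rightarrow> bool" where
  "groebner_basis lt I G \<longleftrightarrow>
     finite G \<and> G \<subseteq> I \<and> Idl\<^bsub>mpoly_ring\<^esub> (lead_term lt ` (G - {0})) = initial_ideal lt I"

definition two_top_monoms :: "('n::finite \<Rightarrow> nat) \<Rightarrow> ('n, 'k::zero) mpoly \<Rightarrow> bool" where
  "two_top_monoms w g \<longleftrightarrow>
     card {a \<in> Poly_Mapping.keys g. \<forall>b\<in>Poly_Mapping.keys g. weight w b \<le> weight w a} = 2"

definition order_domain ::
  "('n::finite \<Rightarrow> nat) \<Rightarrow> ('n monom \<Rightarrow> 'n monom \<Rightarrow> bool) \<Rightarrow> ('n, 'k::field) mpoly set \<Rightarrow> bool" where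
  "order_domain w lt I \<longleftrightarrow>
     (\<exists>G. groebner_basis lt I G \<and> (\<forall>g\<in>G. two_top_monoms w g)) \<and>
     (\<forall>a\<in>staircase lt I. \<forall>b\<in>staircase lt I. a \<noteq> b \<longrightarrow> weight w a \<noteq> weight w b)"

text \<open>The span of the monomials of weight \<open>k\<close>: polynomials supported on monomials of weight \<open>k\<close>.\<close>

definition weight_space :: "('n::finite \<Rightarrow> nat) \<Rightarrow> nat \<Rightarrow> ('n, 'k::zero) mpoly set" where
  "weight_space w k = {p. \<forall>a\<in>Poly_Mapping.keys p. weight w a = k}"

text \<open>
  The dimension of the image of \<^const>\<open>weight_space\<close> in the quotient by \<open>J\<close>, over the image
  of the constant polynomials. If \<open>J\<close> is the whole ring, the scalars and the space collapse to the
  zero ring, and \<^const>\<open>ring.dim\<close> yields \<open>0\<close>, as it should.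
\<close>

definition hilbert_function ::
  "('n::finite \<Rightarrow> nat) \<Rightarrow> ('n, 'k::field) mpoly set \<Rightarrow> nat \<Rightarrow> nat" where
  "hilbert_function w J k =
     ring.dim (mpoly_ring Quot J)
       (range (\<lambda>c. J +>\<^bsub>mpoly_ring\<^esub> Poly_Mapping.single 0 c))
       ((\<lambda>p. J +>\<^bsub>mpoly_ring\<^esub> p) ` weight_space w k)"

abbreviation quasi_period :: "('n::finite \<Rightarrow> nat) \<Rightarrow> nat" where
  "quasi_period w \<equiv> (LCM i. w i)"

text \<open>
  The family is represented by a function on \<open>nat\<close> of which only the values below the period
  matter; these are determined uniquely.
\<close>

definition hilbert_quasi_polynomial ::
  "('n::finite \<Rightarrow> nat) \<Rightarrow> ('n, 'k::field) mpoly set \<Rightarrow> (nat \<Rightarrow> rat poly) \<Rightarrow> bool" where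
  "hilbert_quasi_polynomial w J P \<longleftrightarrow>
     (\<forall>i<quasi_period w. \<forall>\<^sub>F k in sequentially. k mod quasi_period w = i \<longrightarrow>
        of_nat (hilbert_function w J k) = poly (P i) (of_nat k))"

definition regularity_index ::
  "('n::finite \<Rightarrow> nat) \<Rightarrow> ('n, 'k::field) mpoly set \<Rightarrow> (nat \<Rightarrow> rat poly) \<Rightarrow> nat" where
  "regularity_index w J P =
     (LEAST k0. \<forall>k\<ge>k0. of_nat (hilbert_function w J k) = poly (P (k mod quasi_period w)) (of_nat k))"

end

theory Submission
  imports Defs
begin

text \<open>
  The support of a polynomial in the initial ideal \<open>J\<close> contains no monomial of the staircase, so
  the monomials of the staircase are linearly independent modulo \<open>J\<close>. Hence the number of
  staircase monomials of weight \<open>k\<close> is at most the value of the Hilbert function at \<open>k\<close>, which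
  hypothesis (2) bounds by \<open>1\<close>.
\<close>

section \<open>The polynomial ring as a record\<close>

lemma mpoly_ring_simps [simp]:
  "carrier mpoly_ring = UNIV"
  "p \<otimes>\<^bsub>mpoly_ring\<^esub> q = p * q"
  "\<one>\<^bsub>mpoly_ring\<^esub> = 1"
  "\<zero>\<^bsub>mpoly_ring\<^esub> = 0"
  "p \<oplus>\<^bsub>mpoly_ring\<^esub> q = p + q"
  by (simp_all add: ring_of_type_algebra_def)

lemma mpoly_ring_a_inv [simp]: "\<ominus>\<^bsub>mpoly_ring\<^esub> p = - p"
proof -
  interpret R: ring "mpoly_ring :: ('a, 'b) mpoly ring"
    by (rule ring_from_type_algebra)
  show ?thesis
    using R.minus_equality[of "- p" p] by simp
qed

lemma mpoly_ring_a_minus [simp]: "p \<ominus>\<^bsub>mpoly_ring\<^esub> q = p - q"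
  by (simp add: a_minus_def)

text \<open>Additive inverses come from multiplication by \<open>- 1\<close>, and commutativity
  turns absorption on one side into absorption on both.\<close>

lemma mpoly_ring_idealI:
  fixes L :: "('n::finite, 'k::field) mpoly set"
  assumes "0 \<in> L"
    and add: "\<And>p q. p \<in> L \<Longrightarrow> q \<in> L \<Longrightarrow> p + q \<in> L"
    and mult: "\<And>p q. p \<in> L \<Longrightarrow> q * p \<in> L"
  shows "ideal L mpoly_ring"
proof (rule idealI)
  interpret R: ring "mpoly_ring :: ('n, 'k) mpoly ring"
    by (rule ring_from_type_algebra)
  show "ring (mpoly_ring :: ('n, 'k) mpoly ring)"
    by (rule R.ring_axioms)
  have "- p \<in> L" if "p \<in> L" for p
    using mult[OF that, of "- 1"] by simp
  then show "subgroup L (add_monoid mpoly_ring)"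
    using assms by (intro R.add.subgroupI) (auto simp flip: a_inv_def)
qed (use mult in \<open>auto simp: mult.commute\<close>)

text \<open>The copy of the base field inside the ring: linear algebra in HOL-Algebra takes its
  scalars from a subfield of the ring itself.\<close>

abbreviation constants :: "('n::finite, 'k::field) mpoly set" where
  "constants \<equiv> range (Poly_Mapping.single 0)"

lemma subfield_constants: "subfield constants (mpoly_ring :: ('n::finite, 'k::field) mpoly ring)"
proof -
  interpret R: cring "mpoly_ring :: ('n, 'k) mpoly ring"
    by (rule cring_from_type_algebra)
  have "subring constants (mpoly_ring :: ('n, 'k) mpoly ring)"
    by (rule R.subringI)
      (auto simp: mult_single simp flip: single_one single_uminus single_add)
  moreover have "Units (mpoly_ring\<lparr>carrier := constants\<rparr>) = constants - {0 :: ('n, 'k) mpoly}"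
  proof (intro equalityI subsetI)
    fix p :: "('n, 'k) mpoly"
    assume "p \<in> constants - {0}"
    then obtain c where c: "p = Poly_Mapping.single 0 c" "c \<noteq> 0"
      by fastforce
    then have "p * Poly_Mapping.single 0 (inverse c) = 1"
      by (simp add: mult_single)
    then show "p \<in> Units (mpoly_ring\<lparr>carrier := constants\<rparr>)"
      using c by (auto simp: Units_def mult.commute)
  qed (auto simp: Units_def)
  ultimately show ?thesis
    by (intro R.subfieldI R.subcringI) (auto simp: mult.commute)
qed

text \<open>Induction on the list: the term of \<open>p\<close> at the head monomial is split off,
  and the remainder is supported on the tail.\<close>

lemma Span_monomials:
  fixes xs :: "'n::finite monom list"
  shows "ring.Span (mpoly_ring :: ('n, 'k::field) mpoly ring) constants
      (map (\<lambda>a. Poly_Mapping.single a 1) xs) = {p. Poly_Mapping.keys p \<subseteq> set xs}"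
proof -
  interpret R: ring "mpoly_ring :: ('n, 'k) mpoly ring"
    by (rule ring_from_type_algebra)
  show ?thesis
  proof (induction xs)
    case Nil
    then show ?case by simp
  next
    case (Cons a xs)
    let ?E = "{p :: ('n, 'k) mpoly. Poly_Mapping.keys p \<subseteq> set xs}"
    have "(\<exists>k\<in>constants. \<exists>v\<in>?E. p = k * Poly_Mapping.single a 1 + v) \<longleftrightarrow>
        Poly_Mapping.keys p \<subseteq> set (a # xs)" (is "?lhs \<longleftrightarrow> ?rhs") for p
    proof
      assume ?lhs
      then obtain c v where "v \<in> ?E" "p = Poly_Mapping.single a c + v"
        by (auto simp: mult_single)
      then show ?rhs
        using Poly_Mapping.keys_add[of "Poly_Mapping.single a c" v] by (auto split: if_splits)
    next
      assume ?rhs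
      let ?c = "Poly_Mapping.lookup p a"
      have "p - Poly_Mapping.single a ?c \<in> ?E"
      proof (intro CollectI subsetI)
        fix b assume "b \<in> Poly_Mapping.keys (p - Poly_Mapping.single a ?c)"
        with \<open>?rhs\<close> show "b \<in> set xs"
          by (cases "b = a") (auto simp: in_keys_iff lookup_minus lookup_single)
      qed
      moreover have "p = Poly_Mapping.single 0 ?c * Poly_Mapping.single a 1 +
          (p - Poly_Mapping.single a ?c)"
        by (simp add: mult_single)
      ultimately show ?lhs by blast
    qed
    moreover have "R.Span constants (map (\<lambda>a. Poly_Mapping.single a 1) (a # xs)) =
        R.line_extension constants (Poly_Mapping.single a 1) ?E"
      using Cons.IH by simp
    ultimately show ?case
      unfolding set_eq_iff by (simp only: R.line_extension_mem_iff mpoly_ring_simps mem_Collect_eq) simp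
  qed
qed

section \<open>Leading monomials and the staircase\<close>

lemma weight_add: "weight w (a + b) = weight w a + weight w b"
  by (simp add: weight_def lookup_add algebra_simps sum.distrib)

text \<open>Positive weights bound each exponent by the total weight. This makes the weight spaces
  finite-dimensional.\<close>

lemma finite_monomials_of_weight:
  fixes w :: "'n::finite \<Rightarrow> nat"
  assumes "\<And>i. w i > 0"
  shows "finite {a. weight w a = k}"
proof -
  have "Poly_Mapping.lookup a i \<le> weight w a" for a i
  proof -
    have "Poly_Mapping.lookup a i \<le> Poly_Mapping.lookup a i * w i"
      using assms[of i] by simp
    also have "\<dots> \<le> weight w a"
      unfolding weight_def by (rule member_le_sum) auto
    finally show ?thesis .
  qed
  then have "Poly_Mapping.lookup ` {a. weight w a = k} \<subseteq> PiE UNIV (\<lambda>_. {..k})"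
    by auto
  then have "finite (Poly_Mapping.lookup ` {a. weight w a = k})"
    by (rule finite_subset) (simp add: finite_PiE)
  then show ?thesis
    by (rule finite_imageD) (simp add: inj_on_def)
qed

lemma weighted_less_order:
  assumes "monomial_ordering lt"
  shows "transp (weighted_less w lt)" "asymp (weighted_less w lt)" "totalp (weighted_less w lt)"
    and "weighted_less w lt a b \<Longrightarrow> weighted_less w lt (a + c) (b + c)"
proof -
  have lt: "transp lt" "irreflp lt" "totalp lt"
    and add: "\<And>a b c. lt a b \<Longrightarrow> lt (a + c) (b + c)"
    using assms by (auto simp: monomial_ordering_def)
  show trans: "transp (weighted_less w lt)"
    using transpD[OF lt(1)] by (auto intro!: transpI simp: weighted_less_def)
  have irrefl: "irreflp (weighted_less w lt)"
    using irreflpD[OF lt(2)] by (auto intro!: irreflpI simp: weighted_less_def)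
  show "asymp (weighted_less w lt)"
    using transpD[OF trans] irreflpD[OF irrefl] by (blast intro: asympI)
  show "totalp (weighted_less w lt)"
    using totalpD[OF lt(3)] by (fastforce intro!: totalpI simp: weighted_less_def)
  show "weighted_less w lt a b \<Longrightarrow> weighted_less w lt (a + c) (b + c)"
    using add by (auto simp: weighted_less_def weight_add)
qed

lemma lead_monom_eqI:
  assumes "asymp lt" "a \<in> Poly_Mapping.keys p"
    and "\<And>b. b \<in> Poly_Mapping.keys p \<Longrightarrow> b \<noteq> a \<Longrightarrow> lt b a"
  shows "lead_monom lt p = a"
  unfolding lead_monom_def
proof (rule the_equality)
  show "a \<in> Poly_Mapping.keys p \<and> (\<forall>b\<in>Poly_Mapping.keys p. b \<noteq> a \<longrightarrow> lt b a)"
    using assms(2,3) by simp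
  fix b assume b: "b \<in> Poly_Mapping.keys p \<and> (\<forall>c\<in>Poly_Mapping.keys p. c \<noteq> b \<longrightarrow> lt c b)"
  show "b = a"
  proof (rule ccontr)
    assume "b \<noteq> a"
    with assms(2,3) b have "lt b a" "lt a b" by auto
    then show False using asympD[OF assms(1)] by simp
  qed
qed

lemma lead_monom_greatest:
  assumes "transp lt" "asymp lt" "totalp lt" and "p \<noteq> 0"
  shows "lead_monom lt p \<in> Poly_Mapping.keys p"
    and "b \<in> Poly_Mapping.keys p \<Longrightarrow> b \<noteq> lead_monom lt p \<Longrightarrow> lt b (lead_monom lt p)"
proof -
  have "Poly_Mapping.keys p \<noteq> {}"
    using \<open>p \<noteq> 0\<close> by simp
  then obtain a where a: "a \<in> Poly_Mapping.keys p"
      "\<And>b. b \<in> Poly_Mapping.keys p \<Longrightarrow> b \<noteq> a \<Longrightarrow> lt b a"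
    using Finite_Set.bex_greatest_element[of "Poly_Mapping.keys p" lt] assms(1,3)
    by (metis finite_keys transp_on_subset totalp_on_subset subset_UNIV)
  have "lead_monom lt p = a"
    using assms(2) a by (rule lead_monom_eqI)
  with a show "lead_monom lt p \<in> Poly_Mapping.keys p"
    and "b \<in> Poly_Mapping.keys p \<Longrightarrow> b \<noteq> lead_monom lt p \<Longrightarrow> lt b (lead_monom lt p)"
    by auto
qed

lemma lookup_single_times:
  fixes p :: "('n, 'k::semiring_1) mpoly"
  shows "Poly_Mapping.lookup (Poly_Mapping.single c 1 * p) (c + a) = Poly_Mapping.lookup p a"
  by (simp add: lookup_mult lookup_single when_mult)

text \<open>Multiplication by a monomial translates the support, and translation preserves the
  ordering.\<close>

lemma lead_monom_single_times:
  fixes p :: "('n, 'k::semiring_1) mpoly"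
  assumes order: "transp lt" "asymp lt" "totalp lt"
    and add: "\<And>a b c. lt a b \<Longrightarrow> lt (a + c) (b + c)"
    and "p \<noteq> 0"
  shows "lead_monom lt (Poly_Mapping.single c 1 * p) = c + lead_monom lt p"
proof (rule lead_monom_eqI)
  show "c + lead_monom lt p \<in> Poly_Mapping.keys (Poly_Mapping.single c 1 * p)"
    using lead_monom_greatest(1)[OF order \<open>p \<noteq> 0\<close>] by (simp add: in_keys_iff lookup_single_times)
  fix b assume b: "b \<in> Poly_Mapping.keys (Poly_Mapping.single c 1 * p)" "b \<noteq> c + lead_monom lt p"
  then obtain b' where "b = c + b'" "b' \<in> Poly_Mapping.keys p"
    using keys_mult[of "Poly_Mapping.single c 1" p] by (auto split: if_splits)
  with b show "lt b (c + lead_monom lt p)"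
    using add lead_monom_greatest(2)[OF order \<open>p \<noteq> 0\<close>] by (metis add.commute)
qed fact

text \<open>The staircase is closed under divisors, because every multiple of a leading monomial of
  \<open>I\<close> is again one.\<close>

lemma staircase_add_left:
  fixes I :: "('n::finite, 'k::field) mpoly set"
  assumes order: "transp lt" "asymp lt" "totalp lt"
    and add: "\<And>a b c. lt a b \<Longrightarrow> lt (a + c) (b + c)"
    and "ideal I mpoly_ring" and "c + a \<in> staircase lt I"
  shows "a \<in> staircase lt I"
proof (rule ccontr)
  assume "a \<notin> staircase lt I"
  then obtain p where p: "p \<in> I" "p \<noteq> 0" "lead_monom lt p = a"
    by (auto simp: staircase_def)
  let ?q = "Poly_Mapping.single c 1 * p"
  have "lead_monom lt ?q = c + a"
    using lead_monom_single_times[OF order add \<open>p \<noteq> 0\<close>] p(3) by simp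
  moreover have "?q \<in> I"
    using ideal.I_l_closed[OF assms(5) p(1), of "Poly_Mapping.single c 1"] by simp
  \<comment> \<open>The staircase is defined through nonzero elements of \<open>I\<close>, so
    \<open>?q\<close> must be shown to be nonzero.\<close>
  moreover have "Poly_Mapping.lookup ?q (c + a) \<noteq> 0"
    using lead_monom_greatest(1)[OF order p(2)] p(3) by (simp add: lookup_single_times in_keys_iff)
  then have "?q \<noteq> 0" by auto
  ultimately show False
    using \<open>c + a \<in> staircase lt I\<close> by (auto simp: staircase_def)
qed

text \<open>The polynomials whose support avoids the staircase form an ideal containing all leading
  terms, hence containing the ideal that these generate.\<close>

lemma keys_initial_ideal:
  fixes I :: "('n::finite, 'k::field) mpoly set"
  assumes order: "transp lt" "asymp lt" "totalp lt"
    and add: "\<And>a b c. lt a b \<Longrightarrow> lt (a + c) (b + c)"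
    and "ideal I mpoly_ring" and "p \<in> initial_ideal lt I"
  shows "Poly_Mapping.keys p \<inter> staircase lt I = {}"
proof -
  let ?L = "{p :: ('n, 'k) mpoly. Poly_Mapping.keys p \<inter> staircase lt I = {}}"
  interpret R: ring "mpoly_ring :: ('n, 'k) mpoly ring"
    by (rule ring_from_type_algebra)
  have "ideal ?L mpoly_ring"
  proof (rule mpoly_ring_idealI)
    fix p q assume p: "p \<in> ?L"
    show "q * p \<in> ?L"
      \<comment> \<open>Each key of \<open>q * p\<close> is a multiple of a key of \<open>p\<close>;
        if it lay in the staircase, so would that key.\<close>
      using p keys_mult[of q p] staircase_add_left[OF order add assms(5)] by fast
    show "p + q \<in> ?L" if "q \<in> ?L"
      using p that Poly_Mapping.keys_add[of p q] by blast
  qed simp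
  moreover have "lead_term lt ` (I - {0}) \<subseteq> ?L"
    by (auto simp: lead_term_def staircase_def split: if_splits)
  ultimately have "initial_ideal lt I \<subseteq> ?L"
    unfolding initial_ideal_def by (rule R.genideal_minimal)
  with assms(6) show ?thesis by blast
qed

section \<open>The Hilbert function\<close>

lemma weight_space_eq_keys: "weight_space w k = {p. Poly_Mapping.keys p \<subseteq> {a. weight w a = k}}"
  by (auto simp: weight_space_def)

text \<open>A nontrivial combination of monomials of \<open>S\<close> has support meeting
  \<open>S\<close>, so it is not in \<open>J\<close>: the classes of these monomials are independent
  in the quotient.\<close>

lemma card_le_hilbert_function:
  fixes J :: "('n::finite, 'k::field) mpoly set"
  assumes "ideal J mpoly_ring" and "\<And>i. w i > 0"
    and "S \<subseteq> {a. weight w a = k}"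
    and disjoint: "\<And>p. p \<in> J \<Longrightarrow> Poly_Mapping.keys p \<inter> S = {}"
  shows "card S \<le> hilbert_function w J k"
proof (cases "S = {}")
  case False
  interpret J: ideal J "mpoly_ring :: ('n, 'k) mpoly ring" by fact
  let ?h = "\<lambda>p. J +>\<^bsub>mpoly_ring\<^esub> p" and ?Q = "mpoly_ring Quot J"
  interpret h: ring_hom_ring mpoly_ring ?Q ?h
    by (rule J.rcos_ring_hom_ring)
  have h_eq: "?h p = ?h q \<longleftrightarrow> p - q \<in> J" for p q
    using J.quotient_eq_iff_same_a_r_cos[OF \<open>ideal J mpoly_ring\<close>, of p q] by simp
  let ?m = "\<lambda>a. Poly_Mapping.single a (1 :: 'k)"
  from False obtain s where "s \<in> S" by blast
  \<comment> \<open>The scalars of the quotient form a field only if \<open>J\<close> is proper; a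
    monomial of the nonempty set \<open>S\<close> witnesses this.\<close>
  have "\<one>\<^bsub>?Q\<^esub> \<noteq> \<zero>\<^bsub>?Q\<^esub>"
  proof
    assume "\<one>\<^bsub>?Q\<^esub> = \<zero>\<^bsub>?Q\<^esub>"
    then have "1 \<in> J"
      using h_eq[of 1 0] h.hom_one h.hom_zero by simp
    then have "?m s \<in> J"
      using J.I_l_closed[of 1 "?m s"] by simp
    with disjoint \<open>s \<in> S\<close> show False by force
  qed
  then have K: "subfield (?h ` constants) ?Q"
    by (rule h.img_is_subfield[OF subfield_constants])
  have Span: "h.S.Span (?h ` constants) (map (?h \<circ> ?m) xs) = ?h ` {p. Poly_Mapping.keys p \<subseteq> set xs}"
    for xs
    using h.Span_hom[of constants "map ?m xs"] Span_monomials[where 'k = 'k and xs = xs]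
    by (simp del: J.Span.simps h.S.Span.simps)
  have finite: "finite {a. weight w a = k}"
    using assms(2) by (rule finite_monomials_of_weight)
  then obtain xs where xs: "set xs = {a. weight w a = k}"
    using finite_list by blast
  then have "?h ` weight_space w k = h.S.Span (?h ` constants) (map (?h \<circ> ?m) xs)"
    by (simp only: Span weight_space_eq_keys)
  moreover have "set (map (?h \<circ> ?m) xs) \<subseteq> carrier ?Q"
    using h.hom_closed by auto
  \<comment> \<open>Finite dimension is what turns the value of \<open>ring.dim\<close> in
    \<open>hilbert_function\<close> into a genuine \<open>dimension\<close>.\<close>
  ultimately have "h.S.finite_dimension (?h ` constants) (?h ` weight_space w k)"
    using h.S.Span_finite_dimension[OF K] by metis
  then have dim: "h.S.dimension (hilbert_function w J k) (?h ` constants) (?h ` weight_space w k)"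
    using h.S.finite_dimensionE[OF K]
    by (simp add: hilbert_function_def over_def image_image)
  have independent: "h.S.independent (?h ` constants) (map (?h \<circ> ?m) ys)"
    if "distinct ys" "set ys \<subseteq> S" for ys
    using that
  proof (induction ys)
    case Nil
    then show ?case by simp
  next
    case (Cons a ys)
    \<comment> \<open>Otherwise \<open>?m a\<close> would be congruent modulo \<open>J\<close> to
      some \<open>p\<close> supported on \<open>ys\<close>. As \<open>a\<close> is not in
      \<open>ys\<close>, the difference keeps coefficient 1 at \<open>a\<close>, against
      \<open>disjoint\<close>.\<close>
    have "?h (?m a) \<notin> h.S.Span (?h ` constants) (map (?h \<circ> ?m) ys)"
    proof
      assume "?h (?m a) \<in> h.S.Span (?h ` constants) (map (?h \<circ> ?m) ys)"
      then obtain p where p: "Poly_Mapping.keys p \<subseteq> set ys" "?m a - p \<in> J"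
        unfolding Span using h_eq by blast
      with Cons.prems have "Poly_Mapping.lookup (?m a - p) a = 1"
        by (auto simp: lookup_minus in_keys_iff)
      then have "a \<in> Poly_Mapping.keys (?m a - p)"
        by (simp add: in_keys_iff)
      with disjoint[OF p(2)] Cons.prems show False by auto
    qed
    moreover have "h.S.independent (?h ` constants) (map (?h \<circ> ?m) ys)"
      using Cons.prems by (intro Cons.IH) auto
    ultimately have "h.S.independent (?h ` constants) (?h (?m a) # map (?h \<circ> ?m) ys)"
      using h.hom_closed[of "?m a"] by (intro h.li_Cons) simp_all
    then show ?case by (simp add: o_def)
  qed
  obtain ys where ys: "set ys = S" "distinct ys"
    using finite_distinct_list finite_subset[OF assms(3) finite] by blast
  have "set (map (?h \<circ> ?m) ys) \<subseteq> ?h ` weight_space w k"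
    using ys assms(3) by (auto simp: weight_space_def)
  then have "length (map (?h \<circ> ?m) ys) \<le> hilbert_function w J k"
    using ys by (intro h.S.independent_length_le_dimension[OF K dim independent]) auto
  with ys show ?thesis
    using distinct_card[of ys] by simp
qed simp

section \<open>Values of the Hilbert function from its quasi-polynomial\<close>

lemma quasi_period_pos:
  fixes w :: "'n::finite \<Rightarrow> nat"
  assumes "\<And>i. w i > 0"
  shows "quasi_period w > 0"
proof -
  have "0 \<notin> range w"
    using assms by (metis image_iff less_irrefl)
  then show ?thesis
    by (metis Lcm_0_iff finite finite_imageI gr0I)
qed

text \<open>Each residue class has its own threshold; as there are finitely many classes, a common
  threshold exists, so the \<open>LEAST\<close> in \<open>regularity_index\<close> is
  attained.\<close>

lemma hilbert_function_eq_quasi_polynomial: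
  assumes "\<And>i. w i > 0" and "hilbert_quasi_polynomial w J P"
    and "k \<ge> regularity_index w J P"
  shows "of_nat (hilbert_function w J k) = poly (P (k mod quasi_period w)) (of_nat k)"
proof -
  have "\<forall>\<^sub>F k in sequentially. \<forall>i\<in>{..<quasi_period w}. k mod quasi_period w = i \<longrightarrow>
      of_nat (hilbert_function w J k) = poly (P i) (of_nat k)"
    using assms(2) by (intro eventually_ball_finite) (auto simp: hilbert_quasi_polynomial_def)
  then have "\<exists>k0. \<forall>k\<ge>k0.
      of_nat (hilbert_function w J k) = poly (P (k mod quasi_period w)) (of_nat k)"
    using quasi_period_pos[of w, OF assms(1)] by (simp add: eventually_sequentially)
  from LeastI_ex[OF this] show ?thesis
    using assms(3) unfolding regularity_index_def by blast
qed

theorem corollary1: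
  fixes w :: "'n::finite \<Rightarrow> nat"
    and lt_M :: "'n monom \<Rightarrow> 'n monom \<Rightarrow> bool"
    and I G :: "('n, 'k::field) mpoly set"
    and P :: "nat \<Rightarrow> rat poly"
  defines "lt_W \<equiv> weighted_less w lt_M"
  defines "J \<equiv> initial_ideal lt_W I"
  assumes "\<And>i. w i > 0"
    and "monomial_ordering lt_M"
    and "ideal I mpoly_ring"
    and "groebner_basis lt_W I G"
    and "hilbert_quasi_polynomial w J P"
    and "\<And>g. g \<in> G \<Longrightarrow> two_top_monoms w g"
    and "\<And>k. k < regularity_index w J P \<Longrightarrow> hilbert_function w J k \<in> {0, 1}"
    and "\<And>i. i < quasi_period w \<Longrightarrow> P i = 0 \<or> P i = 1"
  shows "order_domain w lt_W I"
proof -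
  \<comment> \<open>Hypothesis (2) covers every weight: directly below the regularity index, and
    through the constant polynomials 0 and 1 from there on.\<close>
  have hilbert_le_1: "hilbert_function w J k \<le> 1" for k
  proof (cases "k < regularity_index w J P")
    case True
    then show ?thesis using assms(9) by force
  next
    case False
    have "k mod quasi_period w < quasi_period w"
      using quasi_period_pos[of w, OF assms(3)] by simp
    then have "of_nat (hilbert_function w J k) \<in> {0, 1 :: rat}"
      using hilbert_function_eq_quasi_polynomial[of w, OF assms(3,7)] assms(10) False by fastforce
    then show ?thesis by auto
  qed
  interpret R: ring "mpoly_ring :: ('n, 'k) mpoly ring"
    by (rule ring_from_type_algebra)
  have J: "ideal J mpoly_ring"
    unfolding J_def initial_ideal_def by (rule R.genideal_ideal) simp
  note order = weighted_less_order[OF assms(4), of w, folded lt_W_def]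
  have "weight w a \<noteq> weight w b"
    if "a \<in> staircase lt_W I" "b \<in> staircase lt_W I" "a \<noteq> b" for a b
  proof
    assume "weight w a = weight w b"
    moreover have "Poly_Mapping.keys p \<inter> {a, b} = {}" if "p \<in> J" for p
      using keys_initial_ideal[OF order assms(5), of p] that \<open>a \<in> _\<close> \<open>b \<in> _\<close>
      by (auto simp: J_def)
    \<comment> \<open>Two distinct staircase monomials of one weight would force the Hilbert
      function to be at least 2 there.\<close>
    ultimately have "card {a, b} \<le> hilbert_function w J (weight w a)"
      using card_le_hilbert_function[where w = w, OF J assms(3), of "{a, b}"] by simp
    with hilbert_le_1[of "weight w a"] \<open>a \<noteq> b\<close> show False by simp
  qed
  \<comment> \<open>The given \<open>G\<close> itself witnesses condition (C1).\<close>
  with assms(6,8) show ?thesis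
    by (auto simp: order_domain_def)
qed

end
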